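(* Let $\mathbf P=(P,\leq,*,1)$ be a strongly sectionally pseudocomplemented poset and $\Theta\in\operatorname{Con}\mathbf P$. Then every class of $\Theta$ is a convex subset of $(P,\leq)$.
   Context: For a poset $(P,\leq)$ and $A\subseteq P$, $U(A)$ and $L(A)$ denote the sets of all upper, respectively lower, bounds of $A$; $U(a,b)=U(\{a,b\})$, $L(b)=L(\{b\})$, $L(U(a,b),c)=L(U(a,b)\cup\{c\})$. The poset is sectionally pseudocomplemented if for all $a,b\in P$ there exists a greatest element $c$ of $P$ with $L(U(a,b),c)=L(b)$; this $c$ is denoted by $a*b$, and one writes $(P,\leq,* )$. A strongly sectionally pseudocomplemented poset is a quadruple $(P,\leq,*,1)$ such that $(P,\leq,* )$ is a sectionally pseudocomplemented poset with greatest element $1$ satisfying $x\leq(x*y)*y$ for all $x,y\in P$. A binary relation $\rho$ on $P$ is $\min$-stable if whenever $(a,b),(c,d)\in\rho$, $a$ is comparable with $c$ and $b$ is comparable with $d$, then $(\min(a,c),\min(b,d))\in\rho$. A congruence on $\mathbf P$ is a $\min$-stable congruence on the algebra $(P,*,1)$; $\operatorname{Con}\mathbf P$ is the set of all of them. A subset $A\subseteq P$ is convex if $x,y\in A$ and $x\leq z\leq y$ imply $z\in A$. *)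

theory Defs
  imports Main
begin

definition upper_bounds :: "'a::order set \<Rightarrow> 'a set" where
  "upper_bounds A = {x. \<forall>a\<in>A. a \<le> x}"

definition lower_bounds :: "'a::order set \<Rightarrow> 'a set" where
  "lower_bounds A = {x. \<forall>a\<in>A. x \<le> a}"

definition is_greatest :: "'a::order set \<Rightarrow> 'a \<Rightarrow> bool" where
  "is_greatest A c \<longleftrightarrow> c \<in> A \<and> (\<forall>d\<in>A. d \<le> c)"

text \<open>
  The poset is the whole type, ordered by its class order. The existence of the greatest element
  required for each pair is witnessed by the operation itself, which is thereby uniquely
  determined.
\<close>

locale sectionally_pseudocomplemented_poset =
  fixes star :: "'a::order \<Rightarrow> 'a \<Rightarrow> 'a"  (infixl "\<star>" 70)
  assumes star_greatest:
    "\<And>a b. is_greatest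
       {c. lower_bounds (upper_bounds {a, b} \<union> {c}) = lower_bounds {b}} (a \<star> b)"

locale strongly_sectionally_pseudocomplemented_poset =
  sectionally_pseudocomplemented_poset star
  for star :: "'a::order \<Rightarrow> 'a \<Rightarrow> 'a"  (infixl "\<star>" 70) +
  fixes one :: 'a
  assumes one_greatest: "is_greatest UNIV one"
    and le_star_star: "\<And>x y. x \<le> (x \<star> y) \<star> y"

text \<open>
  On a partial order the library's \<^term>\<open>min a c\<close> is the minimum only for comparable arguments,
  which is the only case in which it is used here.
\<close>

definition min_stable :: "('a::order \<times> 'a) set \<Rightarrow> bool" where
  "min_stable \<rho> \<longleftrightarrow>
     (\<forall>a b c d. (a, b) \<in> \<rho> \<longrightarrow> (c, d) \<in> \<rho> \<longrightarrow> a \<le> c \<or> c \<le> a \<longrightarrow> b \<le> d \<or> d \<le> b \<longrightarrow>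
        (min a c, min b d) \<in> \<rho>)"

text \<open>
  Compatibility with the constant 1 is an instance of reflexivity, so the constant does not occur.
\<close>

definition algebra_congruence :: "('a \<Rightarrow> 'a \<Rightarrow> 'a) \<Rightarrow> ('a \<times> 'a) set \<Rightarrow> bool" where
  "algebra_congruence star \<Theta> \<longleftrightarrow>
     equiv UNIV \<Theta> \<and>
     (\<forall>a b c d. (a, b) \<in> \<Theta> \<longrightarrow> (c, d) \<in> \<Theta> \<longrightarrow> (star a c, star b d) \<in> \<Theta>)"

definition Con :: "('a::order \<Rightarrow> 'a \<Rightarrow> 'a) \<Rightarrow> ('a \<times> 'a) set set" where
  "Con star = {\<Theta>. algebra_congruence star \<Theta> \<and> min_stable \<Theta>}"

definition order_convex :: "'a::order set \<Rightarrow> bool" where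
  "order_convex A \<longleftrightarrow> (\<forall>x y z. x \<in> A \<longrightarrow> y \<in> A \<longrightarrow> x \<le> z \<longrightarrow> z \<le> y \<longrightarrow> z \<in> A)"

end

theory Submission
  imports Defs
begin

text \<open>
  Let \<open>x \<le> z \<le> y\<close> with \<open>x\<close>, \<open>y\<close> congruent. Then \<open>z \<star> x\<close> is congruent to \<open>z \<star> y = 1\<close>, so
  \<open>(z \<star> x) \<star> x\<close> is congruent to \<open>1 \<star> x = x\<close>. As \<open>z \<le> (z \<star> x) \<star> x\<close> and \<open>x \<le> z\<close>, taking minima with the
  pair \<open>(z, z)\<close> shows that \<open>z\<close> is congruent to \<open>x\<close>.
\<close>

lemma lower_bounds_singleton_inject:
  "lower_bounds {a} = lower_bounds {b} \<Longrightarrow> a = b"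
  by (auto simp: lower_bounds_def set_eq_iff intro: order.antisym)

context strongly_sectionally_pseudocomplemented_poset
begin

lemma le_one: "x \<le> one"
  using one_greatest by (simp add: is_greatest_def)

text \<open>If \<open>a \<le> b\<close>, then \<open>b\<close> is the least upper bound of
  \<open>a\<close> and \<open>b\<close>, so \<open>one\<close> satisfies the condition whose
  greatest solution is \<open>a \<star> b\<close>.\<close>

lemma star_eq_one:
  assumes "a \<le> b"
  shows "a \<star> b = one"
proof -
  have "lower_bounds (upper_bounds {a, b} \<union> {one}) = lower_bounds {b}"
    using assms le_one by (auto simp: lower_bounds_def upper_bounds_def intro: order.trans)
  then have "one \<le> a \<star> b"
    using star_greatest[of a b] by (simp add: is_greatest_def)
  then show ?thesis
    using le_one by (simp add: order.antisym)
qed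

text \<open>The only upper bound of \<open>one\<close> and \<open>b\<close> is \<open>one\<close>,
  so the defining condition says that \<open>one \<star> b\<close> and \<open>b\<close> have the
  same lower bounds.\<close>

lemma one_star: "one \<star> b = b"
proof -
  have "upper_bounds {one, b} = {one}"
    using le_one by (auto simp: upper_bounds_def intro: order.antisym)
  then have "lower_bounds {one, one \<star> b} = lower_bounds {b}"
    using star_greatest[of one b] by (simp add: is_greatest_def insert_commute)
  moreover have "lower_bounds {one, one \<star> b} = lower_bounds {one \<star> b}"
    using le_one by (auto simp: lower_bounds_def)
  ultimately show ?thesis
    by (simp add: lower_bounds_singleton_inject)
qed

lemma Con_between:
  assumes "\<Theta> \<in> Con star" and "(x, y) \<in> \<Theta>" and "x \<le> z" and "z \<le> y"
  shows "(z, x) \<in> \<Theta>"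
proof -
  have equiv: "equiv UNIV \<Theta>"
    and cong: "\<And>a b c d. (a, b) \<in> \<Theta> \<Longrightarrow> (c, d) \<in> \<Theta> \<Longrightarrow> (a \<star> c, b \<star> d) \<in> \<Theta>"
    and min: "min_stable \<Theta>"
    using assms(1) by (auto simp: Con_def algebra_congruence_def)
  have refl: "(a, a) \<in> \<Theta>" for a
    using equiv by (auto simp: equiv_def refl_on_def)
  have "(z \<star> x, one) \<in> \<Theta>"
    using cong[OF refl assms(2), of z] star_eq_one[OF assms(4)] by simp
  then have "((z \<star> x) \<star> x, x) \<in> \<Theta>"
    using cong[OF _ refl, of "z \<star> x" one x] by (simp add: one_star)
  then have "(min z ((z \<star> x) \<star> x), min z x) \<in> \<Theta>"
    using min refl[of z] le_star_star[of z x] assms(3) unfolding min_stable_def by blast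
  moreover have "min z ((z \<star> x) \<star> x) = z"
    using le_star_star by (simp add: min_def)
  \<comment> \<open>\<open>min z x\<close> unfolds to \<open>z\<close> if \<open>z \<le> x\<close>
    and to \<open>x\<close> otherwise; in the first case antisymmetry gives
    \<open>z = x\<close>.\<close>
  moreover have "min z x = x"
    using assms(3) by (auto simp: min_def intro: order.antisym)
  ultimately show ?thesis
    by simp
qed

end

theorem theorem4p1:
  fixes star :: "'a::order \<Rightarrow> 'a \<Rightarrow> 'a" and one :: 'a and \<Theta> :: "('a \<times> 'a) set"
  assumes "strongly_sectionally_pseudocomplemented_poset star one"
    and "\<Theta> \<in> Con star"
  shows "\<forall>A \<in> UNIV // \<Theta>. order_convex A"
proof (unfold order_convex_def, intro ballI allI impI)
  interpret strongly_sectionally_pseudocomplemented_poset star one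
    by (fact assms(1))
  fix A x y z
  assume A: "A \<in> UNIV // \<Theta>" "x \<in> A" "y \<in> A" and le: "x \<le> z" "z \<le> y"
  have equiv: "equiv UNIV \<Theta>"
    using assms(2) by (simp add: Con_def algebra_congruence_def)
  have "(x, y) \<in> \<Theta>"
    using quotient_eq_iff[OF equiv A(1) A(1) A(2) A(3)] by simp
  \<comment> \<open>Symmetry reverses the pair \<open>(z, x)\<close> from
    \<open>Con_between\<close>, since closure of the class starts at its member
    \<open>x\<close>.\<close>
  then have "(x, z) \<in> \<Theta>"
    using Con_between[OF assms(2) _ le] equiv by (auto simp: equiv_def dest: symD)
  then show "z \<in> A"
    using in_quotient_imp_closed[OF equiv A(1) A(2)] by simp
qed

end
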